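(* Let $E,F$ be Banach spaces, $A\in B(E,F)$ double split, $A_0^+\in GI(A)$, $R_0^+=R(A_0^+)$ and $N_0^+=N(A_0^+)=R(I_F-AA_0^+)$. Then the map $$M(\alpha,\beta)=(I_E+\alpha)A_0^+\bigl(I_F-\beta P_{N_0^+}^{R(A)}\bigr)$$ from the Banach space $B(R_0^+,N(A))\times B(N_0^+,R(A))$ onto $GI(A)$ is a smooth ($C^\infty$) diffeomorphism.
   Context: $B(X,Y)$ is the Banach space of bounded linear operators $X\to Y$; $N(\cdot)$ and $R(\cdot)$ denote null space and range. $A\in B(E,F)$ is double split if $R(A)$ is closed and there are closed subspaces $R_+\subset E$, $N_+\subset F$ with $E=N(A)\oplus R_+$ and $F=R(A)\oplus N_+$. A generalized inverse of $A$ is an $A^+\in B(F,E)$ with $AA^+A=A$ and $A^+AA^+=A^+$; $GI(A)\subset B(F,E)$ is the set of all of them, with the smooth structure induced from the Banach space $B(F,E)$. For $A_0^+\in GI(A)$ one has $E=N(A)\oplus R_0^+$ and $F=R(A)\oplus N_0^+$, and $P_{N_0^+}^{R(A)}$ denotes the projection of $F$ onto $N_0^+$ along $R(A)$. The expression $(I_E+\alpha)A_0^+$ makes sense because $A_0^+$ has range $R_0^+$, the domain of $\alpha$: it means $y\mapsto A_0^+y+\alpha(A_0^+y)$. *)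

theory Defs
  imports "HOL-Analysis.Analysis" "HOL-Library.Function_Algebras"
begin

section \<open>Normed spaces on a carrier\<close>

text \<open>
  \<open>B(R\<^sub>0\<^sup>+, N(A))\<close> depends on the operators \<open>A\<close> and \<open>A\<^sub>0\<^sup>+\<close>, so it is not a type. A normed space is
  therefore a carrier, meant to be a linear subspace of some vector space, together with a norm
  that only matters on the carrier.
\<close>

record 'x nspace =
  pts :: "'x set"
  nrm :: "'x \<Rightarrow> real"

definition banach_nspace :: "'x::real_vector nspace \<Rightarrow> bool" where
  "banach_nspace X \<longleftrightarrow>
     subspace (pts X) \<and>
     (\<forall>x\<in>pts X. 0 \<le> nrm X x \<and> (nrm X x = 0 \<longleftrightarrow> x = 0)) \<and>
     (\<forall>c. \<forall>x\<in>pts X. nrm X (c *\<^sub>R x) = \<bar>c\<bar> * nrm X x) \<and>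
     (\<forall>x\<in>pts X. \<forall>y\<in>pts X. nrm X (x + y) \<le> nrm X x + nrm X y) \<and>
     (\<forall>u. (\<forall>n::nat. u n \<in> pts X) \<and>
          (\<forall>e>0. \<exists>N. \<forall>m\<ge>N. \<forall>n\<ge>N. nrm X (u m - u n) < e) \<longrightarrow>
          (\<exists>l\<in>pts X. (\<lambda>n. nrm X (u n - l)) \<longlonglongrightarrow> 0))"

definition whole :: "'x::real_normed_vector nspace" where
  "whole = \<lparr>pts = UNIV, nrm = norm\<rparr>"

text \<open>The norm below is the library's norm on product types.\<close>

definition prod_nspace :: "'x nspace \<Rightarrow> 'y nspace \<Rightarrow> ('x \<times> 'y) nspace" (infixr \<open>\<times>\<^sub>n\<close> 80) where
  "X \<times>\<^sub>n Y = \<lparr>pts = pts X \<times> pts Y, nrm = (\<lambda>(x, y). sqrt ((nrm X x)\<^sup>2 + (nrm Y y)\<^sup>2))\<rparr>"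

instantiation "fun" :: (type, real_vector) real_vector
begin

definition "scaleR c f = (\<lambda>x. c *\<^sub>R f x)"

instance
  by standard (simp_all add: scaleR_fun_def fun_eq_iff scaleR_add_right scaleR_add_left)

end

lemma scaleR_fun_apply [simp]: "(c *\<^sub>R f) x = c *\<^sub>R f x"
  by (simp add: scaleR_fun_def)

text \<open>
  \<open>B(V, W)\<close> for linear subspaces \<open>V\<close> and \<open>W\<close>, with the operator norm. An operator on \<open>V\<close> is
  represented by the function that is \<open>0\<close> outside \<open>V\<close>; this makes the representation unique and
  compatible with the pointwise vector space operations, but it is in general neither linear nor
  continuous on the ambient type. The norm is the library's \<^const>\<open>onorm\<close> with the supremum
  taken over \<open>V\<close> (recall \<open>0 / 0 = 0\<close>).
\<close>

definition op_space ::
  "'a::real_normed_vector set \<Rightarrow> 'b::real_normed_vector set \<Rightarrow> ('a \<Rightarrow> 'b) nspace" where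
  "op_space V W =
     \<lparr>pts = {f. (\<forall>x\<in>V. f x \<in> W) \<and> (\<forall>x. x \<notin> V \<longrightarrow> f x = 0) \<and>
                (\<forall>x\<in>V. \<forall>y\<in>V. f (x + y) = f x + f y) \<and>
                (\<forall>c. \<forall>x\<in>V. f (c *\<^sub>R x) = c *\<^sub>R f x) \<and>
                (\<exists>K. \<forall>x\<in>V. norm (f x) \<le> K * norm x)},
      nrm = (\<lambda>f. SUP x\<in>V. norm (f x) / norm x)\<rparr>"


section \<open>Smooth maps\<close>

definition open_nspace :: "'x::real_vector nspace \<Rightarrow> 'x set \<Rightarrow> bool" where
  "open_nspace X U \<longleftrightarrow>
     U \<subseteq> pts X \<and> (\<forall>x\<in>U. \<exists>e>0. \<forall>y\<in>pts X. nrm X (y - x) < e \<longrightarrow> y \<in> U)"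

text \<open>Bounded \<open>n\<close>-linear maps, with the \<open>n\<close> arguments collected in a list.\<close>

definition bounded_multilinear ::
  "'x::real_vector nspace \<Rightarrow> 'y::real_vector nspace \<Rightarrow> nat \<Rightarrow> ('x list \<Rightarrow> 'y) \<Rightarrow> bool" where
  "bounded_multilinear X Y n T \<longleftrightarrow>
     (\<forall>vs. length vs = n \<and> set vs \<subseteq> pts X \<longrightarrow>
        T vs \<in> pts Y \<and>
        (\<forall>i<n. \<forall>v\<in>pts X. \<forall>w\<in>pts X. T (vs[i := v + w]) = T (vs[i := v]) + T (vs[i := w])) \<and>
        (\<forall>i<n. \<forall>v\<in>pts X. \<forall>c. T (vs[i := c *\<^sub>R v]) = c *\<^sub>R T (vs[i := v]))) \<and>
     (\<exists>K. \<forall>vs. length vs = n \<and> set vs \<subseteq> pts X \<longrightarrow>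
        nrm Y (T vs) \<le> K * prod_list (map (nrm X) vs))"

text \<open>
  \<open>C\<^sup>\<infinity>\<close> on an open set \<open>U\<close>, in the sense of Frechet: \<open>D n x\<close> is the \<open>n\<close>-th derivative at \<open>x\<close>, a
  bounded \<open>n\<close>-linear map, and \<open>D (Suc n)\<close> is the Frechet derivative of \<open>D n\<close> for the operator
  norm on bounded \<open>n\<close>-linear maps, where \<open>L(X, L\<^sup>n(X; Y))\<close> is identified with \<open>L\<^sup>n\<^sup>+\<^sup>1(X; Y)\<close> by
  putting the new direction first.
\<close>

definition smooth_open ::
  "'x::real_vector nspace \<Rightarrow> 'y::real_vector nspace \<Rightarrow> 'x set \<Rightarrow> ('x \<Rightarrow> 'y) \<Rightarrow> bool" where
  "smooth_open X Y U f \<longleftrightarrow>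
     (\<exists>D :: nat \<Rightarrow> 'x \<Rightarrow> 'x list \<Rightarrow> 'y.
        (\<forall>x\<in>U. D 0 x [] = f x) \<and>
        (\<forall>n. \<forall>x\<in>U. bounded_multilinear X Y n (D n x)) \<and>
        (\<forall>n. \<forall>x\<in>U. \<forall>e>0. \<exists>d>0. \<forall>h\<in>pts X. x + h \<in> U \<and> nrm X h < d \<longrightarrow>
           (\<forall>vs. length vs = n \<and> set vs \<subseteq> pts X \<longrightarrow>
              nrm Y (D n (x + h) vs - D n x vs - D (Suc n) x (h # vs))
                \<le> e * nrm X h * prod_list (map (nrm X) vs))))"

text \<open>
  A map on an arbitrary subset \<open>S\<close> is smooth for the structure induced from \<open>X\<close> if it extends
  locally to smooth maps on open subsets of \<open>X\<close>.
\<close>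

definition smooth_on_subset ::
  "'x::real_vector nspace \<Rightarrow> 'y::real_vector nspace \<Rightarrow> 'x set \<Rightarrow> ('x \<Rightarrow> 'y) \<Rightarrow> bool" where
  "smooth_on_subset X Y S f \<longleftrightarrow>
     S \<subseteq> pts X \<and>
     (\<forall>x\<in>S. \<exists>U g. open_nspace X U \<and> x \<in> U \<and> smooth_open X Y U g \<and> (\<forall>z\<in>S \<inter> U. g z = f z))"

text \<open>
  For \<open>S = pts X\<close>, a local smooth extension of the inverse is a local smooth left inverse of \<open>f\<close>, so
  \<open>f\<close> is an embedding with split derivatives: \<open>T\<close> is then a split submanifold of \<open>Y\<close> and the
  condition says that \<open>f\<close> is a diffeomorphism onto this submanifold.
\<close>

definition smooth_diffeomorphism ::
  "'x::real_vector nspace \<Rightarrow> 'x set \<Rightarrow> 'y::real_vector nspace \<Rightarrow> 'y set \<Rightarrow> ('x \<Rightarrow> 'y) \<Rightarrow> bool" where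
  "smooth_diffeomorphism X S Y T f \<longleftrightarrow>
     bij_betw f S T \<and> smooth_on_subset X Y S f \<and> smooth_on_subset Y X T (inv_into S f)"


section \<open>Double split operators and generalized inverses\<close>

definition null_space :: "'a::real_normed_vector \<Rightarrow>\<^sub>L 'b::real_normed_vector \<Rightarrow> 'a set" where
  "null_space A = {x. blinfun_apply A x = 0}"

abbreviation range_space :: "'a::real_normed_vector \<Rightarrow>\<^sub>L 'b::real_normed_vector \<Rightarrow> 'b set" where
  "range_space A \<equiv> range (blinfun_apply A)"

definition direct_sum_decomp :: "'a::real_vector set \<Rightarrow> 'a set \<Rightarrow> bool" where
  "direct_sum_decomp V W \<longleftrightarrow>
     subspace V \<and> subspace W \<and> V \<inter> W = {0} \<and> (\<forall>x. \<exists>v\<in>V. \<exists>w\<in>W. x = v + w)"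

definition double_split :: "'a::real_normed_vector \<Rightarrow>\<^sub>L 'b::real_normed_vector \<Rightarrow> bool" where
  "double_split A \<longleftrightarrow>
     closed (range_space A) \<and>
     (\<exists>Rp. closed Rp \<and> direct_sum_decomp (null_space A) Rp) \<and>
     (\<exists>Np. closed Np \<and> direct_sum_decomp (range_space A) Np)"

definition GI ::
  "'a::real_normed_vector \<Rightarrow>\<^sub>L 'b::real_normed_vector \<Rightarrow> ('b \<Rightarrow>\<^sub>L 'a) set" where
  "GI A = {B. A o\<^sub>L B o\<^sub>L A = A \<and> B o\<^sub>L A o\<^sub>L B = B}"

definition proj_along :: "'a::real_vector set \<Rightarrow> 'a set \<Rightarrow> 'a \<Rightarrow> 'a" where
  "proj_along V W x = (THE v. v \<in> V \<and> x - v \<in> W)"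

definition M_map ::
  "'a::real_normed_vector \<Rightarrow>\<^sub>L 'b::real_normed_vector \<Rightarrow> 'b \<Rightarrow>\<^sub>L 'a \<Rightarrow>
   ('a \<Rightarrow> 'a) \<times> ('b \<Rightarrow> 'b) \<Rightarrow> 'b \<Rightarrow>\<^sub>L 'a" where
  "M_map A Ap = (\<lambda>(\<alpha>, \<beta>). Blinfun (\<lambda>y.
     let z = blinfun_apply Ap (y - \<beta> (proj_along (null_space Ap) (range_space A) y))
     in z + \<alpha> z))"


section \<open>Adequacy of the encodings\<close>

lemma op_space_bound:
  assumes "f \<in> pts (op_space V W)" "x \<in> V"
  shows "norm (f x) \<le> nrm (op_space V W) f * norm x"
proof (cases "x = 0")
  case True
  have "f (0 *\<^sub>R x) = 0 *\<^sub>R f x" using assms by (simp add: op_space_def del: scaleR_zero_left)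
  then show ?thesis using True by simp
next
  case False
  obtain K where K: "\<forall>x\<in>V. norm (f x) \<le> K * norm x" using assms by (auto simp: op_space_def)
  have "bdd_above ((\<lambda>x. norm (f x) / norm x) ` V)"
  proof (rule bdd_aboveI2)
    fix y assume "y \<in> V"
    then show "norm (f y) / norm y \<le> max K 0"
      using K by (cases "y = 0") (auto simp: divide_simps le_max_iff_disj)
  qed
  from cSUP_upper[OF assms(2) this] have "norm (f x) / norm x \<le> nrm (op_space V W) f"
    by (simp add: op_space_def)
  then show ?thesis using False by (simp add: divide_simps)
qed

lemma op_space_le:
  assumes "V \<noteq> {}" "0 \<le> K" "\<And>x. x \<in> V \<Longrightarrow> norm (f x) \<le> K * norm x"
  shows "nrm (op_space V W) f \<le> K"
  unfolding op_space_def nspace.simps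
proof (rule cSUP_least[OF assms(1)])
  fix x assume "x \<in> V"
  then show "norm (f x) / norm x \<le> K"
    using assms(2,3) by (cases "x = 0") (auto simp: divide_simps)
qed

lemma op_space_nonneg:
  assumes "subspace V" "f \<in> pts (op_space V W)"
  shows "0 \<le> nrm (op_space V W) f"
proof -
  obtain K where K: "\<forall>x\<in>V. norm (f x) \<le> K * norm x" using assms by (auto simp: op_space_def)
  have "bdd_above ((\<lambda>x. norm (f x) / norm x) ` V)"
  proof (rule bdd_aboveI2)
    fix y assume "y \<in> V"
    then show "norm (f y) / norm y \<le> max K 0"
      using K by (cases "y = 0") (auto simp: divide_simps le_max_iff_disj)
  qed
  from cSUP_upper[OF subspace_0[OF assms(1)] this] show ?thesis
    by (simp add: op_space_def)
qed

lemma subspace_op_space: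
  assumes V: "subspace V" and W: "subspace W"
  shows "subspace (pts (op_space V W))"
proof (rule subspaceI)
  show "0 \<in> pts (op_space V W)"
    using subspace_0[OF W] by (auto simp: op_space_def intro!: exI[of _ 0])
next
  fix f g assume fg: "f \<in> pts (op_space V W)" "g \<in> pts (op_space V W)"
  have "\<forall>x\<in>V. norm ((f + g) x) \<le> (nrm (op_space V W) f + nrm (op_space V W) g) * norm x"
  proof
    fix x assume "x \<in> V"
    from op_space_bound[OF fg(1) this] op_space_bound[OF fg(2) this]
    show "norm ((f + g) x) \<le> (nrm (op_space V W) f + nrm (op_space V W) g) * norm x"
      using norm_triangle_ineq[of "f x" "g x"] by (simp add: distrib_right)
  qed
  then have "\<exists>K. \<forall>x\<in>V. norm ((f + g) x) \<le> K * norm x" by blast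
  with fg show "f + g \<in> pts (op_space V W)"
    by (auto simp: op_space_def subspace_add[OF W] scaleR_add_right)
next
  fix c f assume f: "f \<in> pts (op_space V W)"
  have "\<forall>x\<in>V. norm ((c *\<^sub>R f) x) \<le> (\<bar>c\<bar> * nrm (op_space V W) f) * norm x"
    using op_space_bound[OF f] by (simp add: mult_left_mono mult.assoc)
  then have "\<exists>K. \<forall>x\<in>V. norm ((c *\<^sub>R f) x) \<le> K * norm x" by blast
  with f show "c *\<^sub>R f \<in> pts (op_space V W)"
    by (auto simp: op_space_def subspace_scale[OF W] scaleR_add_right)
qed

lemma banach_op_space:
  fixes V :: "'a::real_normed_vector set" and W :: "'b::banach set"
  assumes V: "subspace V" and W: "subspace W" "closed W"
  shows "banach_nspace (op_space V W)"
proof -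
  let ?X = "op_space V W"
  note sub = subspace_op_space[OF V W(1)]
  have ne: "V \<noteq> {}" using subspace_0[OF V] by auto
  note nn = op_space_nonneg[OF V]
  note bnd = op_space_bound
  have zero: "nrm ?X f = 0 \<longleftrightarrow> f = 0" if f: "f \<in> pts ?X" for f
  proof
    assume "nrm ?X f = 0"
    then have "f x = 0" for x
      using bnd[OF f, of x] f by (cases "x \<in> V") (auto simp: op_space_def)
    then show "f = 0" by (auto simp: fun_eq_iff)
  next
    assume "f = 0"
    then have "nrm ?X f \<le> 0" by (intro op_space_le[OF ne]) auto
    with nn[OF f] show "nrm ?X f = 0" by simp
  qed
  have scal_le: "nrm ?X (c *\<^sub>R f) \<le> \<bar>c\<bar> * nrm ?X f" if f: "f \<in> pts ?X" for c f
    using bnd[OF f] nn[OF f] by (intro op_space_le[OF ne]) (auto simp: mult_left_mono mult.assoc)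
  have scal: "nrm ?X (c *\<^sub>R f) = \<bar>c\<bar> * nrm ?X f" if f: "f \<in> pts ?X" for c f
  proof (cases "c = 0")
    case True
    then show ?thesis using zero[OF subspace_0[OF sub]] by simp
  next
    case False
    have "nrm ?X (inverse c *\<^sub>R (c *\<^sub>R f)) \<le> \<bar>inverse c\<bar> * nrm ?X (c *\<^sub>R f)"
      by (rule scal_le[OF subspace_scale[OF sub f]])
    then have "\<bar>c\<bar> * nrm ?X f \<le> nrm ?X (c *\<^sub>R f)"
      using False by (simp add: field_simps)
    with scal_le[OF f, of c] show ?thesis by simp
  qed
  have tri: "nrm ?X (f + g) \<le> nrm ?X f + nrm ?X g" if f: "f \<in> pts ?X" and g: "g \<in> pts ?X" for f g
  proof (rule op_space_le[OF ne])
    show "0 \<le> nrm ?X f + nrm ?X g" using nn[OF f] nn[OF g] by simp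
    fix x assume x: "x \<in> V"
    show "norm ((f + g) x) \<le> (nrm ?X f + nrm ?X g) * norm x"
      using bnd[OF f x] bnd[OF g x] norm_triangle_ineq[of "f x" "g x"] by (simp add: distrib_right)
  qed
  have compl: "\<exists>l\<in>pts ?X. (\<lambda>n. nrm ?X (u n - l)) \<longlonglongrightarrow> 0"
    if u: "\<And>n::nat. u n \<in> pts ?X"
      and C: "\<And>e. e > 0 \<Longrightarrow> \<exists>N. \<forall>m\<ge>N. \<forall>n\<ge>N. nrm ?X (u m - u n) < e" for u
  proof -
    have diff: "u m - u n \<in> pts ?X" for m n by (rule subspace_diff[OF sub u u])
    have est: "norm (u m x - u n x) \<le> nrm ?X (u m - u n) * norm x" if "x \<in> V" for m n x
      using bnd[OF diff that] by simp
    have conv: "convergent (\<lambda>n. u n x)" for x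
    proof (cases "x \<in> V")
      case True
      have "Cauchy (\<lambda>n. u n x)"
      proof (rule CauchyI)
        fix e :: real assume "0 < e"
        then have "0 < e / (norm x + 1)" by (simp add: add_nonneg_pos)
        from C[OF this] obtain N
          where N: "\<forall>m\<ge>N. \<forall>n\<ge>N. nrm ?X (u m - u n) < e / (norm x + 1)" by blast
        show "\<exists>M. \<forall>m\<ge>M. \<forall>n\<ge>M. norm (u m x - u n x) < e"
        proof (intro exI allI impI)
          fix m n assume "m \<ge> N" "n \<ge> N"
          with N have "nrm ?X (u m - u n) < e / (norm x + 1)" by blast
          then have "nrm ?X (u m - u n) * (norm x + 1) < e"
            by (simp add: pos_less_divide_eq add_nonneg_pos)
          with est[OF True, of m n] nn[OF diff, of m n] show "norm (u m x - u n x) < e"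
            by (simp add: distrib_left)
        qed
      qed
      then show ?thesis by (simp add: Cauchy_convergent_iff)
    next
      case False
      then have "(\<lambda>n. u n x) = (\<lambda>n. 0)" using u by (auto simp: op_space_def)
      then show ?thesis by (simp add: convergent_const)
    qed
    define l where "l x = lim (\<lambda>n. u n x)" for x
    have lim: "(\<lambda>n. u n x) \<longlonglongrightarrow> l x" for x
      using conv[of x] by (simp add: l_def convergent_LIMSEQ_iff)
    have close: "\<exists>N. \<forall>n\<ge>N. \<forall>x\<in>V. norm (u n x - l x) \<le> e * norm x" if "e > 0" for e
    proof -
      from C[OF that] obtain N where N: "\<forall>m\<ge>N. \<forall>n\<ge>N. nrm ?X (u m - u n) < e" by blast
      have "norm (u n x - l x) \<le> e * norm x" if n: "n \<ge> N" and x: "x \<in> V" for n x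
      proof (rule LIMSEQ_le_const2)
        show "(\<lambda>m. norm (u n x - u m x)) \<longlonglongrightarrow> norm (u n x - l x)"
          by (intro tendsto_intros lim)
        show "\<exists>N. \<forall>m\<ge>N. norm (u n x - u m x) \<le> e * norm x"
        proof (intro exI allI impI)
          fix m assume "m \<ge> N"
          with N n have "nrm ?X (u n - u m) < e" by blast
          then have "nrm ?X (u n - u m) * norm x \<le> e * norm x" by (intro mult_right_mono) auto
          with est[OF x, of n m] show "norm (u n x - u m x) \<le> e * norm x" by simp
        qed
      qed
      then show ?thesis by blast
    qed
    have l: "l \<in> pts ?X"
    proof -
      have "l x \<in> W" if "x \<in> V" for x
        using closed_sequentially[OF W(2) _ lim[of x]] u that by (auto simp: op_space_def)
      moreover have "l x = 0" if "x \<notin> V" for x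
        using LIMSEQ_unique[OF lim[of x], of 0] u that by (auto simp: op_space_def)
      moreover have "l (x + y) = l x + l y" if "x \<in> V" "y \<in> V" for x y
      proof (rule LIMSEQ_unique[OF lim])
        have "(\<lambda>n. u n (x + y)) = (\<lambda>n. u n x + u n y)" using u that by (auto simp: op_space_def)
        then show "(\<lambda>n. u n (x + y)) \<longlonglongrightarrow> l x + l y" using tendsto_add[OF lim[of x] lim[of y]] by simp
      qed
      moreover have "l (c *\<^sub>R x) = c *\<^sub>R l x" if "x \<in> V" for c x
      proof (rule LIMSEQ_unique[OF lim])
        have "(\<lambda>n. u n (c *\<^sub>R x)) = (\<lambda>n. c *\<^sub>R u n x)" using u that by (auto simp: op_space_def)
        then show "(\<lambda>n. u n (c *\<^sub>R x)) \<longlonglongrightarrow> c *\<^sub>R l x"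
          using tendsto_scaleR[OF tendsto_const lim[of x], of c] by simp
      qed
      moreover have "\<exists>K. \<forall>x\<in>V. norm (l x) \<le> K * norm x"
      proof -
        from close[of 1] obtain N where N: "\<forall>x\<in>V. norm (u N x - l x) \<le> norm x" by auto
        have "norm (l x) \<le> (nrm ?X (u N) + 1) * norm x" if "x \<in> V" for x
          using bnd[OF u that, of N] N[rule_format, OF that] norm_triangle_ineq4[of "u N x" "u N x - l x"]
          by (simp add: distrib_right)
        then show ?thesis by blast
      qed
      ultimately show ?thesis by (simp add: op_space_def)
    qed
    have "(\<lambda>n. nrm ?X (u n - l)) \<longlonglongrightarrow> 0"
    proof (rule LIMSEQ_I)
      fix r :: real assume "0 < r"
      then have "0 < r / 2" by simp
      from close[OF this] obtain N
        where N: "\<forall>n\<ge>N. \<forall>x\<in>V. norm (u n x - l x) \<le> r / 2 * norm x" by blast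
      show "\<exists>N. \<forall>n\<ge>N. norm (nrm ?X (u n - l) - 0) < r"
      proof (intro exI allI impI)
        fix n assume "n \<ge> N"
        with N \<open>0 < r\<close> have "nrm ?X (u n - l) \<le> r / 2" by (intro op_space_le[OF ne]) auto
        with nn[OF subspace_diff[OF sub u l], of n] \<open>0 < r\<close>
        show "norm (nrm ?X (u n - l) - 0) < r" by simp
      qed
    qed
    with l show ?thesis by blast
  qed
  show ?thesis
    unfolding banach_nspace_def using sub nn zero scal tri compl by blast
qed

lemma banach_prod_nspace:
  assumes X: "banach_nspace X" and Y: "banach_nspace Y"
  shows "banach_nspace (X \<times>\<^sub>n Y)"
proof -
  let ?Z = "X \<times>\<^sub>n Y"
  have pts: "pts ?Z = pts X \<times> pts Y" by (simp add: prod_nspace_def)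
  have nrm: "nrm ?Z (x, y) = sqrt ((nrm X x)\<^sup>2 + (nrm Y y)\<^sup>2)" for x y
    by (simp add: prod_nspace_def)
  have sX: "subspace (pts X)" and sY: "subspace (pts Y)"
    using X Y by (auto simp: banach_nspace_def)
  have nX: "0 \<le> nrm X x" "nrm X x = 0 \<longleftrightarrow> x = 0" "nrm X (c *\<^sub>R x) = \<bar>c\<bar> * nrm X x"
    if "x \<in> pts X" for x c using X that by (auto simp: banach_nspace_def)
  have nY: "0 \<le> nrm Y y" "nrm Y y = 0 \<longleftrightarrow> y = 0" "nrm Y (c *\<^sub>R y) = \<bar>c\<bar> * nrm Y y"
    if "y \<in> pts Y" for y c using Y that by (auto simp: banach_nspace_def)
  have tX: "nrm X (x + x') \<le> nrm X x + nrm X x'" if "x \<in> pts X" "x' \<in> pts X" for x x'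
    using X that by (auto simp: banach_nspace_def)
  have tY: "nrm Y (y + y') \<le> nrm Y y + nrm Y y'" if "y \<in> pts Y" "y' \<in> pts Y" for y y'
    using Y that by (auto simp: banach_nspace_def)
  note cX = X[unfolded banach_nspace_def, THEN conjunct2, THEN conjunct2, THEN conjunct2,
      THEN conjunct2]
  note cY = Y[unfolded banach_nspace_def, THEN conjunct2, THEN conjunct2, THEN conjunct2,
      THEN conjunct2]
  have sub: "subspace (pts ?Z)"
    unfolding pts by (rule subspace_Times[OF sX sY])
  have pos: "0 \<le> nrm ?Z z \<and> (nrm ?Z z = 0 \<longleftrightarrow> z = 0)" if "z \<in> pts ?Z" for z
    using that nX(2) nY(2) by (cases z) (auto simp: pts nrm sum_power2_eq_zero_iff zero_prod_def)
  have scal: "nrm ?Z (c *\<^sub>R z) = \<bar>c\<bar> * nrm ?Z z" if z: "z \<in> pts ?Z" for z c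
  proof -
    obtain x y where "z = (x, y)" "x \<in> pts X" "y \<in> pts Y" using z by (auto simp: pts)
    then show ?thesis
      by (simp add: nrm nX(3) nY(3) power_mult_distrib real_sqrt_mult flip: distrib_left)
  qed
  have tri: "nrm ?Z (z + z') \<le> nrm ?Z z + nrm ?Z z'" if z: "z \<in> pts ?Z" and z': "z' \<in> pts ?Z" for z z'
  proof -
    obtain x y where xy: "z = (x, y)" "x \<in> pts X" "y \<in> pts Y" using z by (auto simp: pts)
    obtain x' y' where xy': "z' = (x', y')" "x' \<in> pts X" "y' \<in> pts Y" using z' by (auto simp: pts)
    have "nrm ?Z (z + z') \<le> sqrt ((nrm X x + nrm X x')\<^sup>2 + (nrm Y y + nrm Y y')\<^sup>2)"
      unfolding xy(1) xy'(1) add_Pair nrm using xy xy'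
      by (intro real_sqrt_le_mono add_mono power_mono tX tY nX(1) nY(1) subspace_add[OF sX] subspace_add[OF sY])
    also have "\<dots> \<le> nrm ?Z z + nrm ?Z z'"
      unfolding xy(1) xy'(1) nrm by (rule real_sqrt_sum_squares_triangle_ineq)
    finally show ?thesis .
  qed
  have compl: "\<exists>l\<in>pts ?Z. (\<lambda>n. nrm ?Z (u n - l)) \<longlonglongrightarrow> 0"
    if u: "\<And>n::nat. u n \<in> pts ?Z"
      and C: "\<And>e. e > 0 \<Longrightarrow> \<exists>N. \<forall>m\<ge>N. \<forall>n\<ge>N. nrm ?Z (u m - u n) < e" for u
  proof -
    define a b where "a n = fst (u n)" and "b n = snd (u n)" for n
    have ab: "u n = (a n, b n)" "a n \<in> pts X" "b n \<in> pts Y" for n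
      using u[of n] by (auto simp: a_def b_def pts)
    have le: "nrm X (a m - a n) \<le> nrm ?Z (u m - u n)" "nrm Y (b m - b n) \<le> nrm ?Z (u m - u n)" for m n
      by (simp_all add: ab(1) nrm)
    have "\<forall>e>0. \<exists>N. \<forall>m\<ge>N. \<forall>n\<ge>N. nrm X (a m - a n) < e"
      using C order.strict_trans1[OF le(1)] by fast
    then obtain l where l: "l \<in> pts X" "(\<lambda>n. nrm X (a n - l)) \<longlonglongrightarrow> 0"
      using spec[OF cX, of a, THEN mp, OF conjI] ab(2) by blast
    have "\<forall>e>0. \<exists>N. \<forall>m\<ge>N. \<forall>n\<ge>N. nrm Y (b m - b n) < e"
      using C order.strict_trans1[OF le(2)] by fast
    then obtain k where k: "k \<in> pts Y" "(\<lambda>n. nrm Y (b n - k)) \<longlonglongrightarrow> 0"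
      using spec[OF cY, of b, THEN mp, OF conjI] ab(3) by blast
    have "(\<lambda>n. sqrt ((nrm X (a n - l))\<^sup>2 + (nrm Y (b n - k))\<^sup>2)) \<longlonglongrightarrow> sqrt (0\<^sup>2 + 0\<^sup>2)"
      by (intro tendsto_intros l k)
    then have "(\<lambda>n. nrm ?Z (u n - (l, k))) \<longlonglongrightarrow> 0" by (simp add: ab(1) nrm)
    with l k show ?thesis by (auto simp: pts intro!: bexI[of _ "(l, k)"])
  qed
  show ?thesis
    unfolding banach_nspace_def using sub pos scal tri compl by blast
qed

lemma GI_apply:
  assumes "B \<in> GI A"
  shows "blinfun_apply A (blinfun_apply B (blinfun_apply A x)) = blinfun_apply A x"
    and "blinfun_apply B (blinfun_apply A (blinfun_apply B y)) = blinfun_apply B y"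
proof -
  from assms have "A o\<^sub>L B o\<^sub>L A = A" "B o\<^sub>L A o\<^sub>L B = B" by (auto simp: GI_def)
  then have "blinfun_apply (A o\<^sub>L B o\<^sub>L A) x = blinfun_apply A x"
    "blinfun_apply (B o\<^sub>L A o\<^sub>L B) y = blinfun_apply B y" by simp_all
  then show "blinfun_apply A (blinfun_apply B (blinfun_apply A x)) = blinfun_apply A x"
    "blinfun_apply B (blinfun_apply A (blinfun_apply B y)) = blinfun_apply B y"
    by simp_all
qed

lemma null_space_GI:
  assumes "B \<in> GI A"
  shows "null_space B = range_space (id_blinfun - (A o\<^sub>L B))"
proof (intro set_eqI iffI)
  fix y assume "y \<in> null_space B"
  then have "y = blinfun_apply (id_blinfun - (A o\<^sub>L B)) y"
    by (simp add: null_space_def blinfun.diff_left)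
  then show "y \<in> range_space (id_blinfun - (A o\<^sub>L B))" by (rule range_eqI)
next
  fix y assume "y \<in> range_space (id_blinfun - (A o\<^sub>L B))"
  then show "y \<in> null_space B"
    using GI_apply(2)[OF assms]
    by (auto simp: null_space_def blinfun.diff_left blinfun.diff_right)
qed

lemma proj_along_GI:
  assumes "B \<in> GI A"
  shows "proj_along (null_space B) (range_space A) y = y - blinfun_apply A (blinfun_apply B y)"
  unfolding proj_along_def
proof (rule the_equality)
  show "y - blinfun_apply A (blinfun_apply B y) \<in> null_space B \<and>
        y - (y - blinfun_apply A (blinfun_apply B y)) \<in> range_space A"
    using GI_apply(2)[OF assms] by (simp add: null_space_def blinfun.diff_right)
next
  fix v assume v: "v \<in> null_space B \<and> y - v \<in> range_space A"
  then obtain x where x: "y - v = blinfun_apply A x" by auto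
  have "blinfun_apply A (blinfun_apply B (y - v)) = y - v"
    unfolding x by (rule GI_apply(1)[OF assms])
  with v show "v = y - blinfun_apply A (blinfun_apply B y)"
    by (simp add: null_space_def blinfun.diff_right algebra_simps)
qed

lemma closed_range_GI:
  assumes "B \<in> GI A"
  shows "closed (range_space B)"
proof -
  have "range_space B = {x. blinfun_apply B (blinfun_apply A x) = x}"
    using GI_apply(2)[OF assms] by (auto simp: image_iff) metis
  then show ?thesis by (simp add: closed_Collect_eq continuous_intros)
qed

text \<open>The domain of the parametrization is a Banach space.\<close>

lemma banach_M_domain:
  fixes A :: "'a::banach \<Rightarrow>\<^sub>L 'b::banach"
  assumes B: "B \<in> GI A"
  shows "banach_nspace (op_space (range_space B) (null_space A) \<times>\<^sub>n
    op_space (null_space B) (range_space A))"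
proof -
  have A: "A \<in> GI B" using B by (simp add: GI_def)
  have sN: "subspace (null_space T)" for T :: "'c::real_normed_vector \<Rightarrow>\<^sub>L 'd::real_normed_vector"
    by (auto simp: null_space_def subspace_def blinfun.add_right blinfun.scaleR_right)
  have sR: "subspace (range_space T)" for T :: "'c::real_normed_vector \<Rightarrow>\<^sub>L 'd::real_normed_vector"
    by (rule linear_subspace_image[OF _ subspace_UNIV])
      (simp add: blinfun.bounded_linear_right bounded_linear.linear)
  have "closed (null_space A)"
    unfolding null_space_def by (simp add: closed_Collect_eq continuous_intros)
  then show ?thesis
    by (intro banach_prod_nspace banach_op_space sN sR closed_range_GI[OF A])
qed

text \<open>The argument of \<^const>\<open>Blinfun\<close> in \<^const>\<open>M_map\<close> is a bounded linear map.\<close>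

lemma M_map_apply:
  assumes B: "B \<in> GI A"
    and \<alpha>: "\<alpha> \<in> pts (op_space (range_space B) (null_space A))"
    and \<beta>: "\<beta> \<in> pts (op_space (null_space B) (range_space A))"
  shows "blinfun_apply (M_map A B (\<alpha>, \<beta>)) y =
    (let z = blinfun_apply B (y - \<beta> (proj_along (null_space B) (range_space A) y)) in z + \<alpha> z)"
proof -
  define P where "P = id_blinfun - (A o\<^sub>L B)"
  have P: "proj_along (null_space B) (range_space A) = blinfun_apply P"
    by (rule ext) (simp add: P_def proj_along_GI[OF B] blinfun.diff_left)
  have PN: "blinfun_apply P y \<in> null_space B" for y
    using null_space_GI[OF B] by (auto simp: P_def)
  let ?nb = "nrm (op_space (null_space B) (range_space A)) \<beta>"
  let ?na = "nrm (op_space (range_space B) (null_space A)) \<alpha>"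
  have "bounded_linear (\<lambda>y. \<beta> (blinfun_apply P y))"
  proof (rule bounded_linear_intro)
    show "\<beta> (blinfun_apply P (x + y)) = \<beta> (blinfun_apply P x) + \<beta> (blinfun_apply P y)" for x y
      using \<beta> PN by (simp add: op_space_def blinfun.add_right)
    show "\<beta> (blinfun_apply P (r *\<^sub>R x)) = r *\<^sub>R \<beta> (blinfun_apply P x)" for r x
      using \<beta> PN by (simp add: op_space_def blinfun.scaleR_right)
    show "norm (\<beta> (blinfun_apply P x)) \<le> norm x * (norm P * ?nb)" for x
    proof -
      have "norm (\<beta> (blinfun_apply P x)) \<le> ?nb * norm (blinfun_apply P x)"
        by (rule op_space_bound[OF \<beta> PN])
      also have "\<dots> \<le> ?nb * (norm P * norm x)"
      proof (rule mult_left_mono[OF norm_blinfun])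
        show "0 \<le> ?nb"
          by (rule op_space_nonneg[OF _ \<beta>])
            (auto simp: null_space_def subspace_def blinfun.add_right blinfun.scaleR_right)
      qed
      finally show ?thesis by (simp add: mult_ac)
    qed
  qed
  then have bl: "bounded_linear (\<lambda>y. blinfun_apply B (y - \<beta> (blinfun_apply P y)))"
    by (intro bounded_linear_compose[OF blinfun.bounded_linear_right] bounded_linear_sub
        bounded_linear_ident)
  have "subspace (range_space B)"
    by (rule linear_subspace_image[OF _ subspace_UNIV])
      (simp add: blinfun.bounded_linear_right bounded_linear.linear)
  note na = op_space_nonneg[OF this \<alpha>]
  define Z where "Z = (\<lambda>y. blinfun_apply B (y - \<beta> (blinfun_apply P y)))"
  have Z: "bounded_linear Z" and ZR: "\<And>y. Z y \<in> range_space B"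
    using bl by (auto simp: Z_def)
  obtain K where K: "\<And>x. norm (Z x) \<le> norm x * K"
    using bounded_linear.bounded[OF Z] by blast
  have \<alpha>_add: "\<alpha> (x + y) = \<alpha> x + \<alpha> y"
    if "x \<in> range_space B" "y \<in> range_space B" for x y
    using \<alpha> that by (auto simp: op_space_def)
  have \<alpha>_scale: "\<alpha> (c *\<^sub>R x) = c *\<^sub>R \<alpha> x" if "x \<in> range_space B" for x c
    using \<alpha> that by (auto simp: op_space_def)
  have "bounded_linear (\<lambda>y. \<alpha> (Z y))"
  proof (rule bounded_linear_intro)
    show "\<alpha> (Z (x + y)) = \<alpha> (Z x) + \<alpha> (Z y)" for x y
      unfolding linear_add[OF bounded_linear.linear[OF Z]] by (intro \<alpha>_add ZR)
    show "\<alpha> (Z (r *\<^sub>R x)) = r *\<^sub>R \<alpha> (Z x)" for r x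
      unfolding linear_scale[OF bounded_linear.linear[OF Z]] by (intro \<alpha>_scale ZR)
    show "norm (\<alpha> (Z x)) \<le> norm x * (K * ?na)" for x
      using op_space_bound[OF \<alpha> ZR, of x] mult_left_mono[OF K na, of x] by (simp add: mult_ac)
  qed
  then have "bounded_linear (\<lambda>y. Z y + \<alpha> (Z y))" by (rule bounded_linear_add[OF Z])
  then show ?thesis
    by (simp add: M_map_def P Let_def Z_def bounded_linear_Blinfun_apply)
qed

end

(*
  Write B for the given generalized inverse and P = I - A B. Expanding the product,
  M(alpha, beta) = B + (alpha B - B beta P) - alpha B beta P is a quadratic polynomial. If
  C = M(alpha, beta), then C A = (I + alpha) B A and A C = A B - beta P, so alpha and beta are
  the restrictions of C A - I to R(B) and of -A C to N(B). On GI(A) the operator C A - I agrees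
  on R(B) with (I - B A) C A, whose values lie in N(A) for every C; hence the inverse of M is the
  restriction of a bounded linear map defined on the whole space B(F, E).
*)
theory Submission
  imports Defs
begin

section \<open>Polynomial maps of degree two\<close>

text \<open>The domains are carriers that depend on operators, so linearity and boundedness are
  demanded on \<open>pts X\<close> only; values elsewhere are arbitrary.\<close>

definition bounded_linear_nspace ::
  "'x::real_vector nspace \<Rightarrow> 'y::real_vector nspace \<Rightarrow> ('x \<Rightarrow> 'y) \<Rightarrow> bool" where
  "bounded_linear_nspace X Y L \<longleftrightarrow>
     (\<forall>x\<in>pts X. L x \<in> pts Y) \<and>
     (\<forall>x\<in>pts X. \<forall>y\<in>pts X. L (x + y) = L x + L y) \<and>
     (\<forall>c. \<forall>x\<in>pts X. L (c *\<^sub>R x) = c *\<^sub>R L x) \<and>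
     (\<exists>K. \<forall>x\<in>pts X. nrm Y (L x) \<le> K * nrm X x)"

text \<open>The joint constant \<open>K\<close> is what bounds the remainder \<open>b h h\<close> of
  a quadratic map by a multiple of the squared norm of \<open>h\<close>.\<close>

definition bounded_bilinear_nspace ::
  "'x::real_vector nspace \<Rightarrow> 'y::real_vector nspace \<Rightarrow> ('x \<Rightarrow> 'x \<Rightarrow> 'y) \<Rightarrow> bool" where
  "bounded_bilinear_nspace X Y b \<longleftrightarrow>
     (\<forall>x\<in>pts X. bounded_linear_nspace X Y (b x) \<and> bounded_linear_nspace X Y (\<lambda>y. b y x)) \<and>
     (\<exists>K. \<forall>x\<in>pts X. \<forall>y\<in>pts X. nrm Y (b x y) \<le> K * (nrm X x * nrm X y))"

lemma banach_nspaceD: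
  assumes "banach_nspace X"
  shows "subspace (pts X)"
    and "x \<in> pts X \<Longrightarrow> 0 \<le> nrm X x"
    and "nrm X 0 = 0"
    and "x \<in> pts X \<Longrightarrow> y \<in> pts X \<Longrightarrow> nrm X (x + y) \<le> nrm X x + nrm X y"
  using assms subspace_0[of "pts X"] by (auto simp: banach_nspace_def)

lemma bounded_linear_nspace_add:
  assumes "banach_nspace Y" "bounded_linear_nspace X Y L" "bounded_linear_nspace X Y L'"
  shows "bounded_linear_nspace X Y (\<lambda>x. L x + L' x)"
proof -
  note Y = banach_nspaceD[OF assms(1)]
  obtain K K' where K: "\<forall>x\<in>pts X. nrm Y (L x) \<le> K * nrm X x"
    "\<forall>x\<in>pts X. nrm Y (L' x) \<le> K' * nrm X x"
    using assms(2,3) by (auto simp: bounded_linear_nspace_def)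
  have mem: "L x \<in> pts Y" "L' x \<in> pts Y" if "x \<in> pts X" for x
    using assms(2,3) that by (auto simp: bounded_linear_nspace_def)
  have "nrm Y (L x + L' x) \<le> (K + K') * nrm X x" if "x \<in> pts X" for x
  proof -
    have "nrm Y (L x + L' x) \<le> nrm Y (L x) + nrm Y (L' x)"
      by (rule Y(4)[OF mem[OF that]])
    with K that show ?thesis by (fastforce simp: distrib_right)
  qed
  then have "\<exists>K. \<forall>x\<in>pts X. nrm Y (L x + L' x) \<le> K * nrm X x" by blast
  with assms(2,3) mem show ?thesis
    by (simp add: bounded_linear_nspace_def subspace_add[OF Y(1)] scaleR_add_right)
qed

text \<open>The derivatives can be written down: the first at \<open>x\<close> is
  \<open>L h + b x h + b h x\<close>, the second is \<open>b h k + b k h\<close> independently of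
  \<open>x\<close>, and all later ones vanish. Both orders of the arguments occur because
  \<open>b\<close> need not be symmetric. The only nonzero remainder is \<open>b h h\<close>, at
  order 0.\<close>

lemma smooth_open_quadratic:
  assumes X: "banach_nspace X" and Y: "banach_nspace Y" and U: "U \<subseteq> pts X"
    and c: "c \<in> pts Y" and L: "bounded_linear_nspace X Y L"
    and b: "bounded_bilinear_nspace X Y b"
    and f: "\<And>x. x \<in> U \<Longrightarrow> f x = c + L x + b x x"
  shows "smooth_open X Y U f"
proof -
  note Xs = banach_nspaceD[OF X] and Ys = banach_nspaceD[OF Y]
  define D1 where "D1 x h = L h + (b x h + b h x)" for x h
  define D2 where "D2 h k = b h k + b k h" for h k
  define D :: "nat \<Rightarrow> 'a \<Rightarrow> 'a list \<Rightarrow> 'b" where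
    "D n x vs = (if n = 0 then c + L x + b x x else if n = 1 then D1 x (vs ! 0)
       else if n = 2 then D2 (vs ! 0) (vs ! 1) else 0)" for n x vs
  obtain K where K: "\<forall>x\<in>pts X. \<forall>y\<in>pts X. nrm Y (b x y) \<le> K * (nrm X x * nrm X y)"
    using b by (auto simp: bounded_bilinear_nspace_def)
  have b1: "bounded_linear_nspace X Y (b x)" and b2: "bounded_linear_nspace X Y (\<lambda>y. b y x)"
    if "x \<in> pts X" for x using b that by (auto simp: bounded_bilinear_nspace_def)
  have D1: "bounded_linear_nspace X Y (D1 x)" if "x \<in> pts X" for x
    unfolding D1_def by (intro bounded_linear_nspace_add[OF Y] L b1 b2 that)
  have D2: "bounded_linear_nspace X Y (D2 x)" "bounded_linear_nspace X Y (\<lambda>y. D2 y x)"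
    if "x \<in> pts X" for x
    unfolding D2_def by (intro bounded_linear_nspace_add[OF Y] b1 b2 that)+
  have memb: "b x y \<in> pts Y" if "x \<in> pts X" "y \<in> pts X" for x y
    using b1[OF that(1)] that(2) by (auto simp: bounded_linear_nspace_def)
  have memL: "L x \<in> pts Y" if "x \<in> pts X" for x
    using L that by (auto simp: bounded_linear_nspace_def)
  have Ladd: "L (x + y) = L x + L y" if "x \<in> pts X" "y \<in> pts X" for x y
    using L that by (auto simp: bounded_linear_nspace_def)
  have badd: "b x (y + z) = b x y + b x z" "b (y + z) x = b y x + b z x"
    if "x \<in> pts X" "y \<in> pts X" "z \<in> pts X" for x y z
    using b1[OF that(1)] b2[OF that(1)] that by (auto simp: bounded_linear_nspace_def)
  have ml: "bounded_multilinear X Y n (D n x)" if "x \<in> U" for n x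
  proof -
    have x: "x \<in> pts X" using that U by auto
    consider "n = 0" | "n = 1" | "n = 2" | "n > 2" by linarith
    then show ?thesis
    proof cases
      case 1
      have "c + L x + b x x \<in> pts Y"
        by (intro subspace_add[OF Ys(1)] c memL memb x)
      then show ?thesis
        by (auto simp: 1 bounded_multilinear_def D_def)
    next
      case 2
      have "\<exists>K. \<forall>vs. length vs = 1 \<and> set vs \<subseteq> pts X \<longrightarrow>
          nrm Y (D 1 x vs) \<le> K * prod_list (map (nrm X) vs)"
        using D1[OF x] unfolding bounded_linear_nspace_def
        by (elim conjE ex_forward) (auto simp: length_Suc_conv D_def)
      with D1[OF x] show ?thesis
        by (auto simp: 2 bounded_multilinear_def bounded_linear_nspace_def length_Suc_conv D_def)
    next
      case 3
      have "nrm Y (D2 h k) \<le> (K + K) * (nrm X h * nrm X k)" if "h \<in> pts X" "k \<in> pts X" for h k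
      proof -
        have "nrm Y (D2 h k) \<le> nrm Y (b h k) + nrm Y (b k h)"
          unfolding D2_def by (intro Ys(4) memb that)
        moreover have "nrm Y (b h k) \<le> K * (nrm X h * nrm X k)"
          "nrm Y (b k h) \<le> K * (nrm X h * nrm X k)"
          using K that by (auto simp: mult.commute)
        ultimately show ?thesis by (simp add: distrib_right)
      qed
      then have "\<exists>K. \<forall>vs. length vs = 2 \<and> set vs \<subseteq> pts X \<longrightarrow>
          nrm Y (D 2 x vs) \<le> K * prod_list (map (nrm X) vs)"
        by (intro exI[of _ "K + K"]) (auto simp: length_Suc_conv numeral_2_eq_2 D_def)
      then show ?thesis using D2
        by (auto simp: 3 bounded_multilinear_def bounded_linear_nspace_def length_Suc_conv
            numeral_2_eq_2 D_def less_Suc_eq)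
    next
      case 4
      then show ?thesis
        by (auto simp: bounded_multilinear_def D_def subspace_0[OF Ys(1)] Ys(3) intro!: exI[of _ 0])
    qed
  qed
  have deriv: "\<exists>d>0. \<forall>h\<in>pts X. x + h \<in> U \<and> nrm X h < d \<longrightarrow>
           (\<forall>vs. length vs = n \<and> set vs \<subseteq> pts X \<longrightarrow>
              nrm Y (D n (x + h) vs - D n x vs - D (Suc n) x (h # vs))
                \<le> e * nrm X h * prod_list (map (nrm X) vs))"
    if xU: "x \<in> U" and e: "e > 0" for n x and e :: real
  proof -
    have x: "x \<in> pts X" using xU U by auto
    have pl: "0 \<le> prod_list (map (nrm X) vs)" if "set vs \<subseteq> pts X" for vs
      using that by (induction vs) (auto intro!: mult_nonneg_nonneg Xs(2))
    \<comment> \<open>Chosen so that \<open>K * (nrm X h)\<^sup>2\<close> is at most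
      \<open>e * nrm X h\<close> whenever \<open>nrm X h < d\<close>. Nothing forces
      \<open>K\<close> to be positive; passing to \<open>\<bar>K\<bar> + 1\<close> makes the
      denominator positive.\<close>
    define d where "d = e / (\<bar>K\<bar> + 1)"
    have d: "d > 0" using e by (simp add: d_def add_nonneg_pos)
    show ?thesis
    proof (intro exI[of _ d] conjI d ballI impI allI)
      fix h vs
      assume h: "h \<in> pts X" and hd: "x + h \<in> U \<and> nrm X h < d"
        and vs: "length vs = n \<and> set vs \<subseteq> pts X"
      note nh = Xs(2)[OF h]
      show "nrm Y (D n (x + h) vs - D n x vs - D (Suc n) x (h # vs))
                \<le> e * nrm X h * prod_list (map (nrm X) vs)"
      proof (cases "n = 0")
        case True
        have "D n (x + h) vs - D n x vs - D (Suc n) x (h # vs) = b h h"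
          using True x h by (simp add: D_def D1_def Ladd badd subspace_add[OF Xs(1)])
        moreover have "nrm Y (b h h) \<le> e * nrm X h"
        proof -
          have "nrm Y (b h h) \<le> K * (nrm X h * nrm X h)" using K h by blast
          also have "\<dots> \<le> (\<bar>K\<bar> + 1) * (nrm X h * nrm X h)"
            by (intro mult_right_mono mult_nonneg_nonneg nh) auto
          also have "\<dots> \<le> (\<bar>K\<bar> + 1) * (d * nrm X h)"
            using hd by (intro mult_left_mono mult_right_mono nh) auto
          also have "\<dots> = e * nrm X h"
            by (simp add: d_def add_nonneg_eq_0_iff)
          finally show ?thesis .
        qed
        ultimately show ?thesis using True vs by simp
      next
        case False
        \<comment> \<open>For n = 1 the map \<open>D1\<close> is affine in its base point, with
          increment exactly \<open>D2 h v\<close>; for larger n, \<open>D n\<close> does not depend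
          on the base point and \<open>D (Suc n)\<close> is 0.\<close>
        have "D n (x + h) vs - D n x vs - D (Suc n) x (h # vs) = 0"
        proof (cases "n = 1")
          case True
          then obtain v where "vs = [v]" "v \<in> pts X" using vs by (auto simp: length_Suc_conv)
          with True x h show ?thesis by (simp add: D_def D1_def D2_def badd)
        qed (use False in \<open>simp add: D_def\<close>)
        then show ?thesis using e nh pl vs by (simp add: Ys(3))
      qed
    qed
  qed
  show ?thesis
    unfolding smooth_open_def
    using f ml deriv by (intro exI[of _ D]) (simp add: D_def)
qed

text \<open>The quadratic case with constant term and bilinear part both 0.\<close>

lemma smooth_open_bounded_linear:
  assumes X: "banach_nspace X" and Y: "banach_nspace Y" and U: "U \<subseteq> pts X"
    and L: "bounded_linear_nspace X Y L"
  shows "smooth_open X Y U L"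
proof (rule smooth_open_quadratic[OF X Y U _ L])
  show "0 \<in> pts Y" by (rule subspace_0[OF banach_nspaceD(1)[OF Y]])
  then show "bounded_bilinear_nspace X Y (\<lambda>_ _. 0)"
    by (auto simp: bounded_bilinear_nspace_def bounded_linear_nspace_def banach_nspaceD(3)[OF Y]
        intro!: exI[of _ 0])
qed simp

section \<open>Smoothness on subsets, the whole space, and maps into products\<close>

text \<open>A single extension to an open set containing all of \<open>S\<close> serves as the local
  extension at every point.\<close>

lemma smooth_on_subsetI:
  assumes "open_nspace X U" "S \<subseteq> U" "smooth_open X Y U g" "\<And>z. z \<in> S \<Longrightarrow> g z = f z"
  shows "smooth_on_subset X Y S f"
  unfolding smooth_on_subset_def
proof (intro conjI ballI)
  show "S \<subseteq> pts X" using assms(1,2) by (auto simp: open_nspace_def)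
  show "\<exists>U g. open_nspace X U \<and> x \<in> U \<and> smooth_open X Y U g \<and> (\<forall>z\<in>S \<inter> U. g z = f z)"
    if "x \<in> S" for x
    using assms that by (intro exI[of _ U] exI[of _ g]) auto
qed

lemma open_nspace_pts: "open_nspace X (pts X)"
  by (auto simp: open_nspace_def intro: exI[of _ 1])

lemma banach_whole: "banach_nspace (whole :: 'x::banach nspace)"
proof -
  have "\<exists>l. (\<lambda>n. norm (u n - l)) \<longlonglongrightarrow> 0"
    if "\<forall>e>0. \<exists>N. \<forall>m\<ge>N. \<forall>n\<ge>N. norm (u m - u n) < e" for u :: "nat \<Rightarrow> 'x"
  proof -
    have "Cauchy u" using that by (simp add: Cauchy_def dist_norm)
    then obtain l where "u \<longlonglongrightarrow> l" using Cauchy_convergent convergent_def by blast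
    then show ?thesis using LIM_zero tendsto_norm_zero by blast
  qed
  then show ?thesis
    by (auto simp: banach_nspace_def whole_def norm_triangle_ineq)
qed

lemma nrm_prod_nspace_le:
  "nrm X (fst z) \<le> nrm (X \<times>\<^sub>n Y) z" "nrm Y (snd z) \<le> nrm (X \<times>\<^sub>n Y) z"
  by (cases z; simp add: prod_nspace_def)+

text \<open>The constants of the components add up, since sqrt (a^2 + b^2) \<le> a + b for
  nonnegative a and b.\<close>

lemma bounded_linear_nspace_Pair:
  assumes "bounded_linear_nspace X Y L" "bounded_linear_nspace X Z L'"
    and Y: "banach_nspace Y" and Z: "banach_nspace Z"
  shows "bounded_linear_nspace X (Y \<times>\<^sub>n Z) (\<lambda>x. (L x, L' x))"
proof -
  obtain K K' where K: "\<forall>x\<in>pts X. nrm Y (L x) \<le> K * nrm X x"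
    "\<forall>x\<in>pts X. nrm Z (L' x) \<le> K' * nrm X x"
    using assms(1,2) by (auto simp: bounded_linear_nspace_def)
  have "nrm (Y \<times>\<^sub>n Z) (L x, L' x) \<le> (K + K') * nrm X x" if "x \<in> pts X" for x
  proof -
    have "L x \<in> pts Y" "L' x \<in> pts Z"
      using assms(1,2) that by (auto simp: bounded_linear_nspace_def)
    then have "nrm (Y \<times>\<^sub>n Z) (L x, L' x) \<le> nrm Y (L x) + nrm Z (L' x)"
      by (simp add: prod_nspace_def sqrt_sum_squares_le_sum banach_nspaceD(2)[OF Y]
          banach_nspaceD(2)[OF Z])
    with K that show ?thesis by (fastforce simp: distrib_right)
  qed
  then have "\<exists>K. \<forall>x\<in>pts X. nrm (Y \<times>\<^sub>n Z) (L x, L' x) \<le> K * nrm X x" by blast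
  with assms(1,2) show ?thesis by (simp add: bounded_linear_nspace_def) (simp add: prod_nspace_def)
qed

section \<open>Operators on subspaces\<close>

lemma subspace_null_space: "subspace (null_space T)"
  by (auto simp: null_space_def subspace_def blinfun.add_right blinfun.scaleR_right)

lemma subspace_range_space: "subspace (range_space T)"
  by (rule linear_subspace_image[OF _ subspace_UNIV])
    (simp add: blinfun.bounded_linear_right bounded_linear.linear)

lemma closed_null_space: "closed (null_space T)"
  unfolding null_space_def by (simp add: closed_Collect_eq continuous_intros)

lemma op_spaceD:
  assumes "f \<in> pts (op_space V W)"
  shows "x \<in> V \<Longrightarrow> f x \<in> W" "x \<notin> V \<Longrightarrow> f x = 0"
    "x \<in> V \<Longrightarrow> y \<in> V \<Longrightarrow> f (x + y) = f x + f y"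
    "x \<in> V \<Longrightarrow> f (c *\<^sub>R x) = c *\<^sub>R f x"
  using assms by (auto simp: op_space_def)

section \<open>Composing an operator on a subspace with an ambient operator\<close>

text \<open>A representative \<open>f\<close> in \<open>op_space V W\<close> is linear on
  \<open>V\<close> only. After an operator \<open>T\<close> with range in \<open>V\<close>, it never
  sees its artificial zeros outside \<open>V\<close>, and the composite is a genuine bounded
  operator on the whole type.\<close>

definition op_comp ::
  "('a \<Rightarrow> 'b::real_normed_vector) \<Rightarrow> 'c::real_normed_vector \<Rightarrow>\<^sub>L 'a::real_normed_vector \<Rightarrow> 'c \<Rightarrow>\<^sub>L 'b" where
  "op_comp f T = Blinfun (\<lambda>y. f (blinfun_apply T y))"

context
  fixes V :: "'a::real_normed_vector set" and W :: "'b::real_normed_vector set"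
    and T :: "'c::real_normed_vector \<Rightarrow>\<^sub>L 'a"
  assumes V: "subspace V" and T: "range_space T \<subseteq> V"
begin

lemma norm_op_comp_arg:
  assumes f: "f \<in> pts (op_space V W)"
  shows "norm (f (blinfun_apply T y)) \<le> nrm (op_space V W) f * norm T * norm y"
proof -
  have "norm (f (blinfun_apply T y)) \<le> nrm (op_space V W) f * norm (blinfun_apply T y)"
    using T by (intro op_space_bound[OF f]) auto
  also have "\<dots> \<le> nrm (op_space V W) f * (norm T * norm y)"
    by (intro mult_left_mono norm_blinfun op_space_nonneg[OF V f])
  finally show ?thesis by (simp add: mult.assoc)
qed

lemma op_comp_apply:
  assumes f: "f \<in> pts (op_space V W)"
  shows "blinfun_apply (op_comp f T) y = f (blinfun_apply T y)"
proof -
  have "blinfun_apply T x \<in> V" for x using T by auto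
  then have "bounded_linear (\<lambda>y. f (blinfun_apply T y))"
    using f norm_op_comp_arg[OF f]
    by (intro bounded_linear_intro[of _ "nrm (op_space V W) f * norm T"])
      (auto simp: op_space_def blinfun.add_right blinfun.scaleR_right mult_ac)
  then show ?thesis by (simp add: op_comp_def bounded_linear_Blinfun_apply)
qed

lemma norm_op_comp:
  assumes f: "f \<in> pts (op_space V W)"
  shows "norm (op_comp f T) \<le> nrm (op_space V W) f * norm T"
  using norm_op_comp_arg[OF f] op_space_nonneg[OF V f]
  by (intro norm_blinfun_bound) (auto simp: op_comp_apply[OF f])

end

section \<open>Restricting ambient operators to a subspace\<close>

text \<open>The value 0 outside \<open>V\<close> is the normal form that \<open>op_space\<close>
  prescribes.\<close>

definition op_restrict :: "'a set \<Rightarrow> 'a::real_normed_vector \<Rightarrow>\<^sub>L 'b::real_normed_vector \<Rightarrow> 'a \<Rightarrow> 'b" where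
  "op_restrict V T = (\<lambda>x. if x \<in> V then blinfun_apply T x else 0)"

lemma op_restrict_in_op_space:
  assumes V: "subspace V" and T: "range_space T \<subseteq> W"
  shows "op_restrict V T \<in> pts (op_space V W)"
  using T norm_blinfun[of T]
  by (auto simp: op_restrict_def op_space_def blinfun.add_right blinfun.scaleR_right
      subspace_add[OF V] subspace_scale[OF V])

lemma nrm_op_restrict:
  assumes "subspace V"
  shows "nrm (op_space V W) (op_restrict V T) \<le> norm T"
  using subspace_0[OF assms] norm_blinfun[of T]
  by (intro op_space_le) (auto simp: op_restrict_def)

text \<open>Restriction does not increase the norm, so a bound for \<open>J\<close> carries over.
  The range condition concerns every \<open>C\<close>, which makes the map defined on the whole
  space.\<close>

lemma bounded_linear_nspace_op_restrict:
  assumes V: "subspace V" and J: "bounded_linear J"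
    and W: "\<And>C. range_space (J C) \<subseteq> W"
  shows "bounded_linear_nspace whole (op_space V W) (\<lambda>C. op_restrict V (J C))"
proof -
  obtain K where K: "\<And>C. norm (J C) \<le> norm C * K" using bounded_linear.bounded[OF J] by blast
  have "nrm (op_space V W) (op_restrict V (J C)) \<le> K * norm C" for C
    using nrm_op_restrict[OF V, of W "J C"] K[of C] by (simp add: mult.commute)
  then have "\<exists>K. \<forall>C. nrm (op_space V W) (op_restrict V (J C)) \<le> K * norm C" by blast
  then show ?thesis
    by (auto simp: bounded_linear_nspace_def whole_def op_restrict_in_op_space[OF V W])
      (auto simp: op_restrict_def fun_eq_iff linear_add[OF bounded_linear.linear[OF J]]
        linear_scale[OF bounded_linear.linear[OF J]] blinfun.add_left blinfun.scaleR_left)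
qed

section \<open>The parametrization\<close>

context
  fixes A :: "'a::banach \<Rightarrow>\<^sub>L 'b::banach" and B :: "'b \<Rightarrow>\<^sub>L 'a"
  assumes B: "B \<in> GI A"
begin

text \<open>The projection onto N(B) along R(A), as a bounded operator.\<close>

definition null_proj :: "'b \<Rightarrow>\<^sub>L 'b" where "null_proj = id_blinfun - (A o\<^sub>L B)"

abbreviation "XA \<equiv> op_space (range_space B) (null_space A)"
abbreviation "XB \<equiv> op_space (null_space B) (range_space A)"

text \<open>The factor \<open>id_blinfun - (B o\<^sub>L A)\<close> is the projection onto N(A) along
  R(B); it puts the first component into \<open>XA\<close> for every \<open>C\<close>, also outside
  \<open>GI A\<close>.\<close>

definition M_inv :: "'b \<Rightarrow>\<^sub>L 'a \<Rightarrow> ('a \<Rightarrow> 'a) \<times> ('b \<Rightarrow> 'b)" where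
  "M_inv C =
     (op_restrict (range_space B) ((id_blinfun - (B o\<^sub>L A)) o\<^sub>L C o\<^sub>L A),
      op_restrict (null_space B) (- (A o\<^sub>L C)))"

lemma null_proj_apply: "blinfun_apply null_proj y = y - blinfun_apply A (blinfun_apply B y)"
  by (simp add: null_proj_def blinfun.diff_left)

lemma range_null_proj: "range_space null_proj \<subseteq> null_space B"
  using null_space_GI[OF B] by (simp add: null_proj_def)

lemmas comp_\<alpha> = op_comp_apply[OF subspace_range_space, where W = "null_space A"]
lemmas comp_\<beta> = op_comp_apply[OF subspace_null_space range_null_proj, where W = "range_space A"]

text \<open>Separates the terms of degree 0, 1 and 2 in the pair (\<alpha>, \<beta>), as an identity
  between operators on the whole type.\<close>

lemma M_map_blinfun:
  assumes \<alpha>: "\<alpha> \<in> pts XA" and \<beta>: "\<beta> \<in> pts XB"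
  shows "M_map A B (\<alpha>, \<beta>) =
    B + (op_comp \<alpha> B - (B o\<^sub>L op_comp \<beta> null_proj)) + - op_comp \<alpha> (B o\<^sub>L op_comp \<beta> null_proj)"
proof (rule blinfun_eqI)
  fix y
  have proj: "proj_along (null_space B) (range_space A) y = blinfun_apply null_proj y"
    by (simp add: null_proj_apply proj_along_GI[OF B])
  have sub: "range_space (B o\<^sub>L op_comp \<beta> null_proj) \<subseteq> range_space B" by auto
  \<comment> \<open>\<alpha> is additive on R(B) only, so u is split as (u - v) + v inside that
    subspace.\<close>
  have "\<alpha> (u - v) = \<alpha> u - \<alpha> v" if "u \<in> range_space B" "v \<in> range_space B" for u v
    using op_spaceD(3)[OF \<alpha>, of "u - v" v] subspace_diff[OF subspace_range_space that] that
    by simp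
  then show "blinfun_apply (M_map A B (\<alpha>, \<beta>)) y = blinfun_apply
    (B + (op_comp \<alpha> B - (B o\<^sub>L op_comp \<beta> null_proj)) + - op_comp \<alpha> (B o\<^sub>L op_comp \<beta> null_proj)) y"
    by (simp add: M_map_apply[OF B \<alpha> \<beta>] proj Let_def blinfun.add_left blinfun.diff_left
        blinfun.diff_right blinfun.minus_left comp_\<alpha>[OF _ \<alpha>] comp_\<alpha>[OF sub \<alpha>] comp_\<beta>[OF \<beta>])
qed

section \<open>Smoothness of the parametrization\<close>

lemma M_map_smooth: "smooth_open (XA \<times>\<^sub>n XB) whole (pts (XA \<times>\<^sub>n XB)) (M_map A B)"
proof (rule smooth_open_quadratic[OF banach_M_domain[OF B] banach_whole])
  let ?X = "XA \<times>\<^sub>n XB"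
  have ptsX: "\<alpha> \<in> pts XA" "\<beta> \<in> pts XB" if "(\<alpha>, \<beta>) \<in> pts ?X" for \<alpha> \<beta>
    using that by (auto simp: prod_nspace_def)
  \<comment> \<open>This factor of the linear and of the quadratic term has its range in R(B), so
    \<alpha> may be composed with it.\<close>
  define S where "S \<beta> = B o\<^sub>L op_comp \<beta> null_proj" for \<beta> :: "'b \<Rightarrow> 'b"
  have S_apply: "blinfun_apply (S \<beta>) y = blinfun_apply B (\<beta> (blinfun_apply null_proj y))"
    if "\<beta> \<in> pts XB" for \<beta> y by (simp add: S_def comp_\<beta>[OF that])
  have RS: "range_space (S \<beta>) \<subseteq> range_space B" for \<beta> by (auto simp: S_def)
  have S_norm: "norm (S \<beta>) \<le> norm B * norm null_proj * nrm XB \<beta>" if \<beta>: "\<beta> \<in> pts XB" for \<beta>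
  proof -
    have "norm (S \<beta>) \<le> norm B * norm (op_comp \<beta> null_proj)"
      unfolding S_def by (rule norm_blinfun_compose)
    also have "\<dots> \<le> norm B * (nrm XB \<beta> * norm null_proj)"
      by (intro mult_left_mono norm_op_comp[OF subspace_null_space range_null_proj \<beta>]) simp
    finally show ?thesis by (simp add: mult_ac)
  qed
  note subA = subspace_op_space[OF subspace_range_space subspace_null_space, of B A]
    and subB = subspace_op_space[OF subspace_null_space subspace_range_space, of B A]
  have S_add: "S (\<beta> + \<beta>') = S \<beta> + S \<beta>'" if "\<beta> \<in> pts XB" "\<beta>' \<in> pts XB" for \<beta> \<beta>'
    by (rule blinfun_eqI)
      (simp add: S_apply that subspace_add[OF subB that] blinfun.add_left blinfun.add_right)
  have S_scale: "S (c *\<^sub>R \<beta>) = c *\<^sub>R S \<beta>" if "\<beta> \<in> pts XB" for \<beta> c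
    by (rule blinfun_eqI)
      (simp add: S_apply that subspace_scale[OF subB that] blinfun.scaleR_left blinfun.scaleR_right)
  have C_add: "op_comp (\<alpha> + \<alpha>') T = op_comp \<alpha> T + op_comp \<alpha>' T"
    if "\<alpha> \<in> pts XA" "\<alpha>' \<in> pts XA" and T: "range_space T \<subseteq> range_space B"
    for \<alpha> \<alpha>' and T :: "'b \<Rightarrow>\<^sub>L 'a"
    by (rule blinfun_eqI)
      (simp add: comp_\<alpha>[OF T] that subspace_add[OF subA that(1,2)] blinfun.add_left)
  have C_scale: "op_comp (c *\<^sub>R \<alpha>) T = c *\<^sub>R op_comp \<alpha> T"
    if "\<alpha> \<in> pts XA" and T: "range_space T \<subseteq> range_space B" for \<alpha> c and T :: "'b \<Rightarrow>\<^sub>L 'a"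
    by (rule blinfun_eqI)
      (simp add: comp_\<alpha>[OF T] that subspace_scale[OF subA that(1)] blinfun.scaleR_left)
  have C_add_right: "op_comp \<alpha> (T + T') = op_comp \<alpha> T + op_comp \<alpha> T'"
    if \<alpha>: "\<alpha> \<in> pts XA" and T: "range_space T \<subseteq> range_space B" "range_space T' \<subseteq> range_space B"
    for \<alpha> and T T' :: "'b \<Rightarrow>\<^sub>L 'a"
  proof (rule blinfun_eqI)
    fix y
    have mem: "blinfun_apply T y \<in> range_space B" "blinfun_apply T' y \<in> range_space B" for y
      using T by auto
    have "range_space (T + T') \<subseteq> range_space B"
      using subspace_add[OF subspace_range_space mem] by (auto simp: blinfun.add_left)
    then show "blinfun_apply (op_comp \<alpha> (T + T')) y =
        blinfun_apply (op_comp \<alpha> T + op_comp \<alpha> T') y"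
      by (simp add: comp_\<alpha>[OF _ \<alpha>] T blinfun.add_left op_spaceD(3)[OF \<alpha> mem])
  qed
  have C_scale_right: "op_comp \<alpha> (c *\<^sub>R T) = c *\<^sub>R op_comp \<alpha> T"
    if \<alpha>: "\<alpha> \<in> pts XA" and T: "range_space T \<subseteq> range_space B" for \<alpha> c and T :: "'b \<Rightarrow>\<^sub>L 'a"
  proof (rule blinfun_eqI)
    fix y
    have mem: "blinfun_apply T y \<in> range_space B" for y using T by auto
    have "range_space (c *\<^sub>R T) \<subseteq> range_space B"
      using subspace_scale[OF subspace_range_space mem] by (auto simp: blinfun.scaleR_left)
    then show "blinfun_apply (op_comp \<alpha> (c *\<^sub>R T)) y = blinfun_apply (c *\<^sub>R op_comp \<alpha> T) y"
      by (simp add: comp_\<alpha>[OF _ \<alpha>] T blinfun.scaleR_left op_spaceD(4)[OF \<alpha> mem])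
  qed
  define L where "L z = op_comp (fst z) B - S (snd z)" for z :: "('a \<Rightarrow> 'a) \<times> ('b \<Rightarrow> 'b)"
  \<comment> \<open>The term of degree 2, polarized without symmetrizing: \<alpha> is taken from the
    first argument and \<beta> from the second.\<close>
  define b where "b z z' = - op_comp (fst z) (S (snd z'))" for z z' :: "('a \<Rightarrow> 'a) \<times> ('b \<Rightarrow> 'b)"
  have fs: "fst z \<in> pts XA" "snd z \<in> pts XB" if "z \<in> pts ?X" for z
    using that by (auto simp: prod_nspace_def)
  note nA = nrm_prod_nspace_le(1)[of XA _ XB] and nB = nrm_prod_nspace_le(2)[of XB _ XA]
  show "pts ?X \<subseteq> pts ?X" by simp
  show "B \<in> pts whole" by (simp add: whole_def)
  have "norm (L z) \<le> (norm B + norm B * norm null_proj) * nrm ?X z" if z: "z \<in> pts ?X" for z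
  proof -
    have "norm (L z) \<le> norm (op_comp (fst z) B) + norm (S (snd z))"
      unfolding L_def by (rule norm_triangle_ineq4)
    also have "\<dots> \<le> nrm XA (fst z) * norm B + norm B * norm null_proj * nrm XB (snd z)"
      by (intro add_mono S_norm norm_op_comp[OF subspace_range_space] fs[OF z]) simp
    also have "\<dots> \<le> nrm ?X z * norm B + norm B * norm null_proj * nrm ?X z"
      by (intro add_mono mult_left_mono mult_right_mono nA nB) auto
    finally show ?thesis by (simp add: algebra_simps)
  qed
  then have "\<exists>K. \<forall>z\<in>pts ?X. norm (L z) \<le> K * nrm ?X z" by blast
  moreover have "L (c *\<^sub>R z) = c *\<^sub>R L z" if "z \<in> pts ?X" for c z
    using that by (simp add: L_def S_scale C_scale fs scaleR_diff_right)
  ultimately show "bounded_linear_nspace ?X whole L"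
    unfolding bounded_linear_nspace_def
    by (simp add: whole_def) (simp add: L_def S_add C_add fs fst_add snd_add)
  have b_le: "norm (b z z') \<le> norm B * norm null_proj * (nrm ?X z * nrm ?X z')"
    if z: "z \<in> pts ?X" and z': "z' \<in> pts ?X" for z z'
  proof -
    have nn: "0 \<le> nrm XA (fst z)" "0 \<le> nrm XB (snd z')"
      by (rule op_space_nonneg[OF subspace_range_space fs(1)[OF z]],
          rule op_space_nonneg[OF subspace_null_space fs(2)[OF z']])
    have "norm (b z z') \<le> nrm XA (fst z) * norm (S (snd z'))"
      unfolding b_def norm_minus_cancel
      by (rule norm_op_comp[OF subspace_range_space RS fs(1)[OF z]])
    also have "\<dots> \<le> nrm XA (fst z) * (norm B * norm null_proj * nrm XB (snd z'))"
      by (intro mult_left_mono S_norm fs[OF z'] nn)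
    also have "\<dots> = norm B * norm null_proj * (nrm XA (fst z) * nrm XB (snd z'))"
      by (simp add: mult_ac)
    also have "\<dots> \<le> norm B * norm null_proj * (nrm ?X z * nrm ?X z')"
      \<comment> \<open>\<open>mult_mono\<close> asks for a nonnegative norm of \<open>z\<close> in
        the product; it dominates the nonnegative norm of \<open>fst z\<close>.\<close>
      using nn by (intro mult_left_mono mult_mono nA nB order_trans[OF nn(1) nA]) auto
    finally show ?thesis .
  qed
  have "bounded_linear_nspace ?X whole (b z)" if z: "z \<in> pts ?X" for z
    unfolding bounded_linear_nspace_def
  proof (intro conjI)
    show "\<exists>K. \<forall>z'\<in>pts ?X. nrm whole (b z z') \<le> K * nrm ?X z'"
      using b_le[OF z] by (intro exI[of _ "norm B * norm null_proj * nrm ?X z"]) (simp add: whole_def mult_ac)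
  qed (auto simp: whole_def b_def S_add S_scale C_add_right C_scale_right RS fs z fst_add snd_add)
  moreover have "bounded_linear_nspace ?X whole (\<lambda>z. b z z')" if z': "z' \<in> pts ?X" for z'
    unfolding bounded_linear_nspace_def
  proof (intro conjI)
    show "\<exists>K. \<forall>z\<in>pts ?X. nrm whole (b z z') \<le> K * nrm ?X z"
      using b_le[OF _ z'] by (intro exI[of _ "norm B * norm null_proj * nrm ?X z'"]) (simp add: whole_def mult_ac)
  qed (auto simp: whole_def b_def C_add C_scale RS fs z' fst_add snd_add)
  ultimately show "bounded_bilinear_nspace ?X whole b"
    unfolding bounded_bilinear_nspace_def using b_le
    by (auto simp: whole_def intro!: exI[of _ "norm B * norm null_proj"])
  show "M_map A B z = B + L z + b z z" if "z \<in> pts ?X" for z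
    using that by (cases z) (simp add: L_def b_def S_def M_map_blinfun ptsX)
qed

section \<open>The inverse as a bounded linear map\<close>

text \<open>Both components restrict operators that are linear in \<open>C\<close>. The ranges fit
  because A (I - B A) = 0 and because A C takes values in R(A).\<close>

lemma M_inv_bounded_linear: "bounded_linear_nspace whole (XA \<times>\<^sub>n XB) M_inv"
proof -
  have 1: "bounded_linear (\<lambda>C. (id_blinfun - (B o\<^sub>L A)) o\<^sub>L C o\<^sub>L A)"
    and 2: "bounded_linear (\<lambda>C :: 'b \<Rightarrow>\<^sub>L 'a. - (A o\<^sub>L C))"
    by (intro bounded_linear_minus bounded_linear_compose[OF bounded_bilinear.bounded_linear_left
        [OF bounded_bilinear_blinfun_compose]] bounded_bilinear.bounded_linear_right
        [OF bounded_bilinear_blinfun_compose])+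
  have 3: "range_space ((id_blinfun - (B o\<^sub>L A)) o\<^sub>L C o\<^sub>L A) \<subseteq> null_space A" for C
    using GI_apply(1)[OF B] by (auto simp: null_space_def blinfun.diff_left blinfun.diff_right)
  have 4: "range_space (- (A o\<^sub>L C)) \<subseteq> range_space A" for C :: "'b \<Rightarrow>\<^sub>L 'a"
    by (auto simp: blinfun.minus_left simp flip: blinfun.minus_right)
  \<comment> \<open>The defining equations are symmetric in \<open>A\<close> and \<open>B\<close>.
    Hence R(A) is the fixed point set of A B, which is closed; this makes \<open>XB\<close>
    complete.\<close>
  have "A \<in> GI B" using B by (simp add: GI_def)
  then have "closed (range_space A)" by (rule closed_range_GI)
  then show ?thesis
    unfolding M_inv_def
    by (intro bounded_linear_nspace_Pair bounded_linear_nspace_op_restrict 1 2 3 4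
        subspace_range_space subspace_null_space banach_op_space closed_null_space)
qed

section \<open>Algebra of the parametrization and its inverse\<close>

text \<open>The first identity holds because P A = 0, which removes \<beta>. The second holds
  because A \<alpha> = 0 and because A B is the identity on R(A), where \<beta> takes its
  values.\<close>

lemma M_map_compose:
  assumes \<alpha>: "\<alpha> \<in> pts XA" and \<beta>: "\<beta> \<in> pts XB"
  defines "C \<equiv> M_map A B (\<alpha>, \<beta>)"
  shows "blinfun_apply C (blinfun_apply A x) =
      blinfun_apply B (blinfun_apply A x) + \<alpha> (blinfun_apply B (blinfun_apply A x))"
    and "blinfun_apply A (blinfun_apply C y) =
      blinfun_apply A (blinfun_apply B y) - \<beta> (blinfun_apply null_proj y)"
proof -
  have C: "blinfun_apply C y = (let z = blinfun_apply B (y - \<beta> (blinfun_apply null_proj y)) in z + \<alpha> z)" for y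
    unfolding C_def M_map_apply[OF B \<alpha> \<beta>] by (simp add: null_proj_apply proj_along_GI[OF B])
  have "\<beta> 0 = 0" using op_spaceD(4)[OF \<beta> subspace_0[OF subspace_null_space], of 0] by simp
  then show "blinfun_apply C (blinfun_apply A x) =
      blinfun_apply B (blinfun_apply A x) + \<alpha> (blinfun_apply B (blinfun_apply A x))"
    by (simp add: C Let_def null_proj_apply GI_apply(1)[OF B])
  have "blinfun_apply A (\<alpha> (blinfun_apply B u)) = 0" for u
    using op_spaceD(1)[OF \<alpha>, of "blinfun_apply B u"] by (simp add: null_space_def)
  moreover have "blinfun_apply A (blinfun_apply B (\<beta> (blinfun_apply null_proj y))) = \<beta> (blinfun_apply null_proj y)"
  proof -
    have "blinfun_apply null_proj y \<in> null_space B" using range_null_proj by auto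
    from op_spaceD(1)[OF \<beta> this] show ?thesis using GI_apply(1)[OF B] by auto
  qed
  ultimately show "blinfun_apply A (blinfun_apply C y) =
      blinfun_apply A (blinfun_apply B y) - \<beta> (blinfun_apply null_proj y)"
    by (simp add: C Let_def blinfun.add_right) (simp add: blinfun.diff_right)
qed

text \<open>A C A = A B A = A, since A kills the values of \<alpha>. Moreover B A C = B (I - \<beta>
  P), and applying I + \<alpha> turns this into C A C = C.\<close>

lemma M_map_in_GI:
  assumes \<alpha>: "\<alpha> \<in> pts XA" and \<beta>: "\<beta> \<in> pts XB"
  shows "M_map A B (\<alpha>, \<beta>) \<in> GI A"
proof -
  let ?C = "M_map A B (\<alpha>, \<beta>)"
  note comp = M_map_compose[OF \<alpha> \<beta>]
  have "blinfun_apply A (blinfun_apply ?C (blinfun_apply A x)) = blinfun_apply A x" for x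
    using op_spaceD(1)[OF \<alpha>, of "blinfun_apply B (blinfun_apply A x)"]
    by (simp add: comp(1) blinfun.add_right GI_apply(1)[OF B] null_space_def)
  moreover have "blinfun_apply ?C (blinfun_apply A (blinfun_apply ?C y)) = blinfun_apply ?C y" for y
  proof -
    have "blinfun_apply B (blinfun_apply A (blinfun_apply ?C y)) =
        blinfun_apply B (y - \<beta> (blinfun_apply null_proj y))"
      by (simp add: comp(2) blinfun.diff_right GI_apply(2)[OF B])
    then show ?thesis
      unfolding comp(1) by (simp add: M_map_apply[OF B \<alpha> \<beta>] null_proj_apply proj_along_GI[OF B] Let_def)
  qed
  ultimately show ?thesis by (auto simp: GI_def intro!: blinfun_eqI)
qed

text \<open>On R(B) the operator B A is the identity, so C A = I + \<alpha> there, and I - B A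
  removes I and keeps \<alpha>. On N(B) one has A B = 0 and P = I, so - A C = \<beta>. Off these
  subspaces both sides are 0 by convention.\<close>

lemma M_inv_M_map:
  assumes \<alpha>: "\<alpha> \<in> pts XA" and \<beta>: "\<beta> \<in> pts XB"
  shows "M_inv (M_map A B (\<alpha>, \<beta>)) = (\<alpha>, \<beta>)"
proof -
  note comp = M_map_compose[OF \<alpha> \<beta>]
  have "op_restrict (range_space B) ((id_blinfun - (B o\<^sub>L A)) o\<^sub>L M_map A B (\<alpha>, \<beta>) o\<^sub>L A) x = \<alpha> x" for x
  proof (cases "x \<in> range_space B")
    case True
    then have "blinfun_apply B (blinfun_apply A x) = x" using GI_apply(2)[OF B] by auto
    moreover have "blinfun_apply A (\<alpha> x) = 0"
      using op_spaceD(1)[OF \<alpha> True] by (simp add: null_space_def)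
    ultimately show ?thesis
      using True by (simp add: op_restrict_def comp(1) blinfun.diff_left blinfun.add_right)
  qed (simp add: op_restrict_def op_spaceD(2)[OF \<alpha>])
  moreover have "op_restrict (null_space B) (- (A o\<^sub>L M_map A B (\<alpha>, \<beta>))) y = \<beta> y" for y
    by (cases "y \<in> null_space B")
      (simp_all add: op_restrict_def op_spaceD(2)[OF \<beta>] comp(2) blinfun.minus_left null_space_def
        null_proj_apply)
  ultimately show ?thesis by (simp add: M_inv_def fun_eq_iff)
qed

text \<open>Since A C A = A, the inner factor B (I + A C P) equals B A C. As A B A = A and C A C =
  C, applying I + \<alpha> gives B A C + (I - B A) C = C.\<close>

lemma M_map_M_inv:
  assumes C: "C \<in> GI A"
  shows "M_map A B (M_inv C) = C"
proof (rule blinfun_eqI)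
  fix y
  obtain \<alpha> \<beta> where ab: "M_inv C = (\<alpha>, \<beta>)" by fastforce
  \<comment> \<open>Read off from the typing part of bounded linearity of
    \<open>M_inv\<close>.\<close>
  have "M_inv C \<in> pts (XA \<times>\<^sub>n XB)"
    using M_inv_bounded_linear by (simp add: bounded_linear_nspace_def whole_def)
  then have mem: "\<alpha> \<in> pts XA" "\<beta> \<in> pts XB" by (auto simp: ab prod_nspace_def)
  have \<alpha>: "\<alpha> = op_restrict (range_space B) ((id_blinfun - (B o\<^sub>L A)) o\<^sub>L C o\<^sub>L A)"
    and \<beta>: "\<beta> = op_restrict (null_space B) (- (A o\<^sub>L C))" using ab by (auto simp: M_inv_def)
  have "blinfun_apply null_proj y \<in> null_space B" using range_null_proj by auto
  then have "blinfun_apply B (y - \<beta> (blinfun_apply null_proj y)) =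
      blinfun_apply B (blinfun_apply A (blinfun_apply C y))"
    by (simp add: \<beta> op_restrict_def blinfun.minus_left blinfun.add_right blinfun.diff_right null_proj_apply
        GI_apply[OF B] GI_apply[OF C])
  then show "blinfun_apply (M_map A B (M_inv C)) y = blinfun_apply C y"
    by (simp add: ab M_map_apply[OF B mem] Let_def null_proj_apply[symmetric] proj_along_GI[OF B])
      (simp add: \<alpha> op_restrict_def blinfun.diff_left GI_apply[OF B] GI_apply[OF C])
qed

text \<open>\<open>M_inv\<close> is a two-sided inverse between the parameter space and
  \<open>GI A\<close>, and at the same time a smooth map on all of B(F, E). It is therefore one
  global smooth extension of the inverse, as the induced structure on \<open>GI A\<close>
  requires.\<close>

lemma M_map_diffeomorphism:
  "smooth_diffeomorphism (XA \<times>\<^sub>n XB) (pts (XA \<times>\<^sub>n XB)) whole (GI A) (M_map A B)"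
proof -
  let ?X = "XA \<times>\<^sub>n XB"
  have M_GI: "M_map A B z \<in> GI A" and inv: "M_inv (M_map A B z) = z" if "z \<in> pts ?X" for z
    using that by (auto simp: prod_nspace_def M_map_in_GI M_inv_M_map)
  have inv_in: "M_inv C \<in> pts ?X" for C
    using M_inv_bounded_linear by (simp add: bounded_linear_nspace_def whole_def)
  have bij: "bij_betw (M_map A B) (pts ?X) (GI A)"
    by (rule bij_betw_byWitness[where f' = M_inv]) (auto simp: inv M_map_M_inv M_GI inv_in)
  \<comment> \<open>By injectivity, the preimage chosen by \<open>inv_into\<close> must be
    \<open>M_inv C\<close>; outside \<open>GI A\<close> the two need not agree.\<close>
  have "M_inv C = inv_into (pts ?X) (M_map A B) C" if "C \<in> GI A" for C
    using inv_into_f_eq[OF bij_betw_imp_inj_on[OF bij] inv_in M_map_M_inv[OF that]] by simp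
  moreover have "smooth_open whole ?X (pts whole) M_inv"
    by (intro smooth_open_bounded_linear banach_whole banach_M_domain[OF B] M_inv_bounded_linear
        subset_refl)
  ultimately have "smooth_on_subset whole ?X (GI A) (inv_into (pts ?X) (M_map A B))"
    by (intro smooth_on_subsetI[OF open_nspace_pts, where g = M_inv]) (simp_all add: whole_def)
  moreover have "smooth_on_subset ?X whole (pts ?X) (M_map A B)"
    by (rule smooth_on_subsetI[OF open_nspace_pts subset_refl M_map_smooth]) simp
  ultimately show ?thesis using bij by (simp add: smooth_diffeomorphism_def)
qed

end

theorem theorem4p1:
  fixes A :: "'a::banach \<Rightarrow>\<^sub>L 'b::banach" and Ap :: "'b \<Rightarrow>\<^sub>L 'a"
  assumes "double_split A" and "Ap \<in> GI A"
  shows "let R0 = range_space Ap;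
             N0 = null_space Ap;
             X = op_space R0 (null_space A) \<times>\<^sub>n op_space N0 (range_space A)
         in smooth_diffeomorphism X (pts X) whole (GI A) (M_map A Ap)"
  using M_map_diffeomorphism[OF assms(2)] by (simp add: Let_def)

end
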